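(* Let $n\in\mathbb{N}$, let $\phi=(\phi_1,\dots,\phi_n):U^n\to U^n$ be holomorphic, and let $p,q>0$. Then the following statements are equivalent: (a) $C_\phi$ is a bounded operator from $\mathcal{B}^p(U^n)$ to $\mathcal{B}^q(U^n)$; (b) $C_\phi$ is a bounded operator from $\mathcal{B}^p_0(U^n)$ to $\mathcal{B}^q(U^n)$; (c) there is an $M\ge 0$ such that for all $z\in U^n$, $$\sum_{k,l=1}^n\left|\frac{\partial \phi_l}{\partial z_k}(z)\right|\frac{(1-|z_k|^2)^q}{(1-|\phi_l(z)|^2)^p}\le M.$$
   Context: $U$ is the open unit disk in $\mathbb{C}$ and $U^n\subset\mathbb{C}^n$ is the open unit polydisk. For a holomorphic self-map $\phi$ of $U^n$, the composition operator is $C_\phi f=f\circ\phi$ for $f$ holomorphic on $U^n$. For $p>0$, the $p$-Bloch space $\mathcal{B}^p(U^n)$ is the Banach space of holomorphic $f:U^n\to\mathbb{C}$ with finite norm $$\|f\|_{\mathcal{B}^p}=|f(0)|+\sup_{z\in U^n}\sum_{k=1}^n\left|\frac{\partial f}{\partial z_k}(z)\right|(1-|z_k|^2)^p .$$ The little $p$-Bloch space $\mathcal{B}^p_0(U^n)$ is the closure of the (holomorphic) polynomials in $\mathcal{B}^p(U^n)$, with the same norm. Saying $C_\phi$ is a bounded operator from $X$ to $Y$ means that $C_\phi$ maps $X$ into $Y$ and is bounded for the respective norms. *)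

theory Defs
  imports "HOL-Complex_Analysis.Complex_Analysis"
begin

text \<open>
  The space \<open>\<complex>\<^sup>n\<close> is \<^typ>\<open>complex ^ 'n\<close>. A function on the polydisc is represented by a total function;
  its values outside the polydisc play no role in any notion below.
\<close>

definition polydisc :: "(complex ^ 'n) set" where
  "polydisc = {z. \<forall>k. cmod (z $ k) < 1}"

text \<open>
  Complex differentiability in several variables: the library's \<open>holomorphic_on\<close> covers only
  functions of one complex variable, and \<open>has_derivative\<close> is real Frechet differentiability, so
  complex homogeneity of the derivative has to be added.
\<close>

definition holomorphic_cn_on :: "(complex ^ 'n \<Rightarrow> complex) \<Rightarrow> (complex ^ 'n) set \<Rightarrow> bool" where
  "holomorphic_cn_on f S \<longleftrightarrow>
     (\<forall>z\<in>S. \<exists>D. (f has_derivative D) (at z within S) \<and> (\<forall>c v. D (c *s v) = c * D v))"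

definition holomorphic_map_on :: "(complex ^ 'n \<Rightarrow> complex ^ 'm) \<Rightarrow> (complex ^ 'n) set \<Rightarrow> bool" where
  "holomorphic_map_on \<phi> S \<longleftrightarrow> (\<forall>l. holomorphic_cn_on (\<lambda>z. \<phi> z $ l) S)"

definition partial_deriv :: "'n \<Rightarrow> (complex ^ 'n \<Rightarrow> complex) \<Rightarrow> complex ^ 'n \<Rightarrow> complex" where
  "partial_deriv k f z = deriv (\<lambda>w. f (\<chi> i. if i = k then w else z $ i)) (z $ k)"

definition bloch_density :: "real \<Rightarrow> (complex ^ 'n \<Rightarrow> complex) \<Rightarrow> complex ^ 'n \<Rightarrow> real" where
  "bloch_density p f z =
     (\<Sum>k\<in>UNIV. cmod (partial_deriv k f z) * (1 - (cmod (z $ k))\<^sup>2) powr p)"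

text \<open>
  The real-valued supremum is meaningful only when the density is bounded on the polydisc; this
  is part of the definition of the space \<open>bloch\<close>.
\<close>

definition bloch_norm :: "real \<Rightarrow> (complex ^ 'n \<Rightarrow> complex) \<Rightarrow> real" where
  "bloch_norm p f = cmod (f 0) + (SUP z\<in>polydisc. bloch_density p f z)"

definition bloch :: "real \<Rightarrow> (complex ^ 'n \<Rightarrow> complex) set" where
  "bloch p = {f. holomorphic_cn_on f polydisc \<and> bdd_above (bloch_density p f ` polydisc)}"

definition polynomial_fun :: "(complex ^ 'n \<Rightarrow> complex) \<Rightarrow> bool" where
  "polynomial_fun P \<longleftrightarrow>
     (\<exists>(A :: ('n \<Rightarrow> nat) set) c. finite A \<and>
        P = (\<lambda>z. \<Sum>\<alpha>\<in>A. c \<alpha> * (\<Prod>i\<in>UNIV. (z $ i) ^ \<alpha> i)))"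

text \<open>
  For \<open>p > 0\<close> every polynomial lies in \<open>bloch p\<close>, so the difference below is in \<open>bloch p\<close> and its
  norm is a genuine finite supremum.
\<close>

definition little_bloch :: "real \<Rightarrow> (complex ^ 'n \<Rightarrow> complex) set" where
  "little_bloch p =
     {f \<in> bloch p. \<forall>\<epsilon>>0. \<exists>P. polynomial_fun P \<and> bloch_norm p (\<lambda>z. f z - P z) < \<epsilon>}"

definition comp_op :: "(complex ^ 'n \<Rightarrow> complex ^ 'n) \<Rightarrow> (complex ^ 'n \<Rightarrow> complex) \<Rightarrow> complex ^ 'n \<Rightarrow> complex" where
  "comp_op \<phi> f = f \<circ> \<phi>"

text \<open>
  Linearity is not demanded here, since composition operators are linear.
\<close>

definition bounded_operator ::
    "('f \<Rightarrow> 'g) \<Rightarrow> 'f set \<Rightarrow> ('f \<Rightarrow> real) \<Rightarrow> 'g set \<Rightarrow> ('g \<Rightarrow> real) \<Rightarrow> bool" where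
  "bounded_operator T X normX Y normY \<longleftrightarrow>
     T ` X \<subseteq> Y \<and> (\<exists>C. \<forall>f\<in>X. normY (T f) \<le> C * normX f)"

end

theory Submission
  imports Defs
begin

no_notation fps_nth (infixl \<open>$\<close> 75)

text \<open>
  For \<open>(c) \<Longrightarrow> (a)\<close>, apply the chain rule to \<open>f \<circ> \<phi>\<close>; the value \<open>f (\<phi> 0)\<close> is controlled by integrating
  the gradient of \<open>f\<close> along the segment from \<open>0\<close> to \<open>\<phi> 0\<close>. For \<open>(b) \<Longrightarrow> (c)\<close>, fix \<open>w\<close> and \<open>l\<close>, put
  \<open>a = \<phi> w $ l\<close>, and test on \<open>f z = g (z $ l)\<close> with \<open>g' x = (1 - cnj a * x) powr (-p)\<close> and \<open>g 0 = 0\<close>.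
  Since \<open>cmod (1 - cnj a * x) \<ge> 1 - cmod x\<close>, the norm of \<open>f\<close> is at most \<open>2 powr p\<close>, independently
  of \<open>a\<close>, and since \<open>g\<close> extends to a disc of radius larger than \<open>1\<close>, its Taylor polynomials converge
  to \<open>f\<close> in the Bloch norm. The density of \<open>f \<circ> \<phi>\<close> at \<open>w\<close> is the \<open>l\<close>-th part of the sum in \<open>(c)\<close>.
\<close>

section \<open>The polydisc and elementary estimates for the Bloch norm\<close>

lemma zero_in_polydisc: "0 \<in> polydisc"
  by (simp add: polydisc_def)

lemma open_polydisc: "open (polydisc :: (complex ^ 'n) set)"
proof -
  have "polydisc = (\<Inter>k\<in>UNIV. {z :: complex ^ 'n. cmod (z $ k) < 1})"
    by (auto simp: polydisc_def)
  moreover have "open {z :: complex ^ 'n. cmod (z $ k) < 1}" for k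
    by (intro open_Collect_less continuous_intros)
  ultimately show ?thesis by (metis open_INT finite)
qed

lemma one_minus_cmod_square_pos:
  assumes "cmod a < 1" shows "0 < 1 - (cmod a)\<^sup>2"
  using assms by (simp add: power_less_one_iff abs_square_less_1)

lemma bloch_density_nonneg: "0 \<le> bloch_density p f z"
  by (simp add: bloch_density_def sum_nonneg)

lemma bloch_density_le_norm:
  assumes "f \<in> bloch p" "z \<in> polydisc"
  shows "bloch_density p f z \<le> bloch_norm p f"
proof -
  have "bloch_density p f z \<le> (SUP z\<in>polydisc. bloch_density p f z)"
    using assms by (auto simp: bloch_def intro: cSUP_upper)
  then show ?thesis by (simp add: bloch_norm_def add_increasing)
qed

lemma cmod_0_le_bloch_norm:
  assumes "f \<in> bloch p"
  shows "cmod (f 0) \<le> bloch_norm p f"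
proof -
  have "0 \<le> bloch_density p f 0" by (rule bloch_density_nonneg)
  also have "\<dots> \<le> (SUP z\<in>polydisc. bloch_density p f z)"
    using assms zero_in_polydisc by (auto simp: bloch_def intro: cSUP_upper)
  finally show ?thesis by (simp add: bloch_norm_def)
qed

lemma bloch_norm_nonneg: "f \<in> bloch p \<Longrightarrow> 0 \<le> bloch_norm p f"
  using cmod_0_le_bloch_norm[of f p] norm_ge_zero[of "f 0"] by linarith

lemma bloch_norm_le:
  fixes f :: "complex ^ 'n \<Rightarrow> complex"
  assumes "\<And>z. z \<in> polydisc \<Longrightarrow> bloch_density p f z \<le> B"
  shows "bloch_norm p f \<le> cmod (f 0) + B"
proof -
  have "(polydisc :: (complex ^ 'n) set) \<noteq> {}" using zero_in_polydisc by blast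
  then show ?thesis
    unfolding bloch_norm_def using assms by (intro add_left_mono cSUP_least) auto
qed

section \<open>Complex derivatives and partial derivatives in several variables\<close>

text \<open>A vector is the sum of its coordinates placed on the axes, and each
  \<open>axis l\<close> is bounded linear. This turns coordinatewise holomorphy into a derivative of
  the whole map \<open>\<phi>\<close>, as the chain rule requires.\<close>

lemma has_derivative_vecI:
  fixes f :: "'a::real_normed_vector \<Rightarrow> 'b::euclidean_space ^ 'n"
  assumes "\<And>l. ((\<lambda>x. f x $ l) has_derivative (\<lambda>v. f' v $ l)) F"
  shows "(f has_derivative f') F"
proof -
  have "linear (axis l :: 'b \<Rightarrow> 'b ^ 'n)" for l
    by (simp add: linear_iff vec_eq_iff axis_def)
  then have bl: "bounded_linear (axis l :: 'b \<Rightarrow> 'b ^ 'n)" for l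
    by (simp add: linear_conv_bounded_linear)
  have "((\<lambda>x. \<Sum>l\<in>UNIV. axis l (f x $ l)) has_derivative (\<lambda>v. \<Sum>l\<in>UNIV. axis l (f' v $ l))) F"
    by (rule has_derivative_sum) (rule bounded_linear.has_derivative[OF bl assms])
  moreover have "(\<Sum>l\<in>UNIV. axis l (x $ l)) = x" for x :: "'b ^ 'n"
    by (simp add: vec_eq_iff axis_def)
  ultimately show ?thesis by simp
qed

text \<open>Additivity and complex homogeneity determine the derivative by its values on the
  standard basis; restricting \<open>f\<close> to the \<open>k\<close>-th coordinate line identifies
  the value at \<open>axis k 1\<close> as the partial derivative.\<close>

lemma has_derivative_partial_deriv:
  fixes f :: "complex ^ 'n \<Rightarrow> complex"
  assumes "holomorphic_cn_on f polydisc" and z: "z \<in> polydisc"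
  shows "(f has_derivative (\<lambda>v. \<Sum>k\<in>UNIV. partial_deriv k f z * v $ k)) (at z)"
proof -
  obtain D where D: "(f has_derivative D) (at z)" and hom: "\<And>c v. D (c *s v) = c * D v"
    using assms at_within_open[OF z open_polydisc] unfolding holomorphic_cn_on_def by metis
  have lin: "linear D" using D has_derivative_linear by blast
  have pd: "partial_deriv k f z = D (axis k 1)" for k
  proof -
    let ?e = "\<lambda>w. \<chi> i. if i = k then w else z $ i"
    have e_der: "(?e has_derivative (\<lambda>h. h *s axis k 1)) (at (z $ k))"
    proof -
      have "?e = (\<lambda>w. z + (w - z $ k) *s axis k 1)"
        by (auto simp: fun_eq_iff vec_eq_iff axis_def)
      moreover have "bounded_linear (\<lambda>h. h *s (axis k 1 :: complex ^ 'n))"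
        by (intro linear_conv_bounded_linear[THEN iffD1])
           (simp add: linear_iff vec_eq_iff axis_def)
      then have "((\<lambda>w. z + (w - z $ k) *s axis k 1) has_derivative (\<lambda>h. h *s axis k 1)) (at (z $ k))"
        using bounded_linear.has_derivative[OF _ has_derivative_diff[OF has_derivative_ident has_derivative_const]]
          has_derivative_add[OF has_derivative_const]
        by fastforce
      ultimately show ?thesis by simp
    qed
    have "?e (z $ k) = z" by (simp add: vec_eq_iff)
    with D have "(f has_derivative D) (at (?e (z $ k)))" by simp
    \<comment> \<open>Homogeneity makes the composed derivative multiplication by the complex number
      \<open>D (axis k 1)\<close>, so the real derivative is a field derivative.\<close>
    from has_derivative_compose[OF e_der this]
    have "((\<lambda>w. f (?e w)) has_derivative (\<lambda>h. D (axis k 1) * h)) (at (z $ k))"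
      by (simp add: hom mult.commute)
    then have "((\<lambda>w. f (?e w)) has_field_derivative D (axis k 1)) (at (z $ k))"
      by (simp add: has_field_derivative_def)
    then show ?thesis unfolding partial_deriv_def by (rule DERIV_imp_deriv)
  qed
  have "D v = (\<Sum>k\<in>UNIV. partial_deriv k f z * v $ k)" for v
  proof -
    have "D v = D (\<Sum>k\<in>UNIV. v $ k *s axis k 1)" by (simp add: basis_expansion)
    also have "\<dots> = (\<Sum>k\<in>UNIV. D (v $ k *s axis k 1))" by (rule linear_sum[OF lin])
    finally show ?thesis by (simp add: hom pd mult.commute)
  qed
  then show ?thesis using D by presburger
qed

text \<open>Derivatives at a point are unique, so evaluation at \<open>axis k 1\<close> compares
  coefficients. It serves to read partial derivatives off the chain rule.\<close>

lemma partial_deriv_eqI: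
  fixes f :: "complex ^ 'n \<Rightarrow> complex"
  assumes hol: "holomorphic_cn_on f polydisc" and z: "z \<in> polydisc"
    and der: "(f has_derivative (\<lambda>v. \<Sum>k\<in>UNIV. d k * v $ k)) (at z)"
  shows "partial_deriv k f z = d k"
proof -
  have "(\<lambda>v. \<Sum>k\<in>UNIV. partial_deriv k f z * v $ k) = (\<lambda>v. \<Sum>k\<in>UNIV. d k * v $ k)"
    using has_derivative_unique[OF has_derivative_partial_deriv[OF hol z] der] .
  from fun_cong[OF this, of "axis k 1"] show ?thesis
    by (simp add: axis_def if_distrib[of "\<lambda>x. _ * x"] cong: if_cong)
qed

section \<open>Composition with a holomorphic self-map\<close>

context
  fixes \<phi> :: "complex ^ 'n \<Rightarrow> complex ^ 'n"
  assumes \<phi>_hol: "holomorphic_map_on \<phi> polydisc"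
    and \<phi>_self: "\<phi> ` polydisc \<subseteq> polydisc"
begin

no_notation fps_nth (infixl \<open>$\<close> 75)

lemma comp_has_derivative:
  assumes f: "holomorphic_cn_on f polydisc" and z: "z \<in> polydisc"
  shows "(f \<circ> \<phi> has_derivative
    (\<lambda>v. \<Sum>k\<in>UNIV. (\<Sum>l\<in>UNIV. partial_deriv l f (\<phi> z) * partial_deriv k (\<lambda>w. \<phi> w $ l) z) * v $ k)) (at z)"
proof -
  have "(\<phi> has_derivative (\<lambda>v. \<chi> l. \<Sum>k\<in>UNIV. partial_deriv k (\<lambda>w. \<phi> w $ l) z * v $ k)) (at z)"
    using \<phi>_hol z
    by (intro has_derivative_vecI) (simp add: has_derivative_partial_deriv holomorphic_map_on_def)
  moreover have "\<phi> z \<in> polydisc" using \<phi>_self z by blast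
  ultimately have "(f \<circ> \<phi> has_derivative (\<lambda>v. \<Sum>l\<in>UNIV. partial_deriv l f (\<phi> z) *
      (\<Sum>k\<in>UNIV. partial_deriv k (\<lambda>w. \<phi> w $ l) z * v $ k))) (at z)"
    using has_derivative_compose[OF _ has_derivative_partial_deriv[OF f]] by (fastforce simp: o_def)
  moreover have "(\<Sum>l\<in>UNIV. partial_deriv l f (\<phi> z) * (\<Sum>k\<in>UNIV. partial_deriv k (\<lambda>w. \<phi> w $ l) z * v $ k))
     = (\<Sum>k\<in>UNIV. (\<Sum>l\<in>UNIV. partial_deriv l f (\<phi> z) * partial_deriv k (\<lambda>w. \<phi> w $ l) z) * v $ k)" for v
    unfolding sum_distrib_left sum_distrib_right
    by (subst sum.swap) (simp add: mult.assoc)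
  ultimately show ?thesis by simp
qed

lemma comp_holomorphic:
  assumes "holomorphic_cn_on f polydisc"
  shows "holomorphic_cn_on (f \<circ> \<phi>) polydisc"
  unfolding holomorphic_cn_on_def
proof
  fix z :: "complex ^ 'n" assume "z \<in> polydisc"
  from comp_has_derivative[OF assms this]
  show "\<exists>D. (f \<circ> \<phi> has_derivative D) (at z within polydisc) \<and> (\<forall>c v. D (c *s v) = c * D v)"
    by (intro exI conjI, rule has_derivative_at_withinI) (auto simp: sum_distrib_left mult_ac)
qed

lemma partial_deriv_comp:
  assumes "holomorphic_cn_on f polydisc" and "z \<in> polydisc"
  shows "partial_deriv k (f \<circ> \<phi>) z =
    (\<Sum>l\<in>UNIV. partial_deriv l f (\<phi> z) * partial_deriv k (\<lambda>w. \<phi> w $ l) z)"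
  by (rule partial_deriv_eqI[OF comp_holomorphic[OF assms(1)] assms(2) comp_has_derivative[OF assms]])

text \<open>One summand of the density is at most the whole, so each partial derivative of
  \<open>f\<close> at \<open>\<phi> z\<close> is at most the norm divided by its weight. In the
  chain rule these weights become the denominators in the assumption on \<open>M\<close>.\<close>

lemma bloch_density_comp_le:
  assumes f: "f \<in> bloch p" and z: "z \<in> polydisc"
    and M: "(\<Sum>k\<in>UNIV. \<Sum>l\<in>UNIV. cmod (partial_deriv k (\<lambda>w. \<phi> w $ l) z)
       * ((1 - (cmod (z $ k))\<^sup>2) powr q / (1 - (cmod (\<phi> z $ l))\<^sup>2) powr p)) \<le> M"
  shows "bloch_density q (f \<circ> \<phi>) z \<le> M * bloch_norm p f"
proof -
  let ?w = "\<phi> z" and ?N = "bloch_norm p f"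
  let ?d = "\<lambda>k l. cmod (partial_deriv k (\<lambda>w. \<phi> w $ l) z)"
  have w: "?w \<in> polydisc" using \<phi>_self z by blast
  have hol: "holomorphic_cn_on f polydisc" using f by (simp add: bloch_def)
  have pos: "0 < (1 - (cmod (?w $ l))\<^sup>2) powr p" for l
    using one_minus_cmod_square_pos[of "?w $ l"] w by (simp add: polydisc_def)
  have grad: "cmod (partial_deriv l f ?w) \<le> ?N / (1 - (cmod (?w $ l))\<^sup>2) powr p" for l
  proof -
    have "cmod (partial_deriv l f ?w) * (1 - (cmod (?w $ l))\<^sup>2) powr p \<le> bloch_density p f ?w"
      unfolding bloch_density_def by (rule member_le_sum) auto
    also have "\<dots> \<le> ?N" by (rule bloch_density_le_norm[OF f w])
    finally show ?thesis using pos[of l] by (simp add: pos_le_divide_eq)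
  qed
  have "bloch_density q (f \<circ> \<phi>) z
      \<le> (\<Sum>k\<in>UNIV. (\<Sum>l\<in>UNIV. (?N / (1 - (cmod (?w $ l))\<^sup>2) powr p) * ?d k l) * (1 - (cmod (z $ k))\<^sup>2) powr q)"
    unfolding bloch_density_def partial_deriv_comp[OF hol z]
    by (intro sum_mono mult_right_mono order.trans[OF norm_sum])
       (auto simp: norm_mult simp del: times_divide_eq_left intro: mult_right_mono grad)
  also have "\<dots> = (\<Sum>k\<in>UNIV. \<Sum>l\<in>UNIV. ?d k l
       * ((1 - (cmod (z $ k))\<^sup>2) powr q / (1 - (cmod (\<phi> z $ l))\<^sup>2) powr p)) * ?N"
    by (simp add: sum_distrib_left sum_distrib_right mult_ac)
  also have "\<dots> \<le> M * ?N" by (intro mult_right_mono M bloch_norm_nonneg f)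
  finally show ?thesis .
qed

end

text \<open>On the segment from \<open>0\<close> to \<open>w\<close> no coordinate exceeds that of
  \<open>w\<close> in modulus, so the weights at \<open>w\<close> bound the gradient along all of
  it, and the mean value inequality applies. The factor in front of the norm does not depend on
  \<open>f\<close>.\<close>

lemma bloch_growth:
  fixes f :: "complex ^ 'n \<Rightarrow> complex"
  assumes f: "f \<in> bloch p" and w: "w \<in> polydisc" and "p > 0"
  shows "cmod (f w - f 0) \<le> (\<Sum>l\<in>UNIV. 1 / (1 - (cmod (w $ l))\<^sup>2) powr p) * norm w * bloch_norm p f"
proof -
  let ?N = "bloch_norm p f"
  let ?K = "\<Sum>l\<in>UNIV. 1 / (1 - (cmod (w $ l))\<^sup>2) powr p"
  let ?D = "\<lambda>x v. \<Sum>k\<in>UNIV. partial_deriv k f x * v $ k"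
  have hol: "holomorphic_cn_on f polydisc" using f by (simp add: bloch_def)
  have seg: "cmod (x $ l) \<le> cmod (w $ l)" if x: "x \<in> closed_segment 0 w" for x l
  proof -
    obtain t where t: "0 \<le> t" "t \<le> 1" "x = t *\<^sub>R w"
      using x by (auto simp: in_segment)
    then show ?thesis by (simp add: mult_left_le_one_le)
  qed
  have w1: "cmod (w $ l) < 1" for l using w by (simp add: polydisc_def)
  have seg_sub: "x \<in> polydisc" if "x \<in> closed_segment 0 w" for x
    using le_less_trans[OF seg[OF that] w1] by (simp add: polydisc_def)
  have "norm (f w - f 0) \<le> (?K * ?N) * norm (w - 0)"
  proof (rule differentiable_bound)
    fix x assume x: "x \<in> closed_segment 0 w"
    show "(f has_derivative ?D x) (at x within closed_segment 0 w)"
      by (rule has_derivative_at_withinI[OF has_derivative_partial_deriv[OF hol seg_sub[OF x]]])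
    have grad: "cmod (partial_deriv l f x) \<le> ?N / (1 - (cmod (w $ l))\<^sup>2) powr p" for l
    proof -
      have "cmod (partial_deriv l f x) * (1 - (cmod (w $ l))\<^sup>2) powr p
          \<le> cmod (partial_deriv l f x) * (1 - (cmod (x $ l))\<^sup>2) powr p"
        using seg[OF x, of l] one_minus_cmod_square_pos[OF w1[of l]] \<open>p > 0\<close>
        by (intro mult_left_mono powr_mono2) (auto intro: power_mono)
      also have "\<dots> \<le> bloch_density p f x"
        unfolding bloch_density_def by (rule member_le_sum) auto
      also have "\<dots> \<le> ?N" by (rule bloch_density_le_norm[OF f seg_sub[OF x]])
      finally show ?thesis
        using one_minus_cmod_square_pos[OF w1[of l]] by (simp add: pos_le_divide_eq)
    qed
    show "onorm (?D x) \<le> ?K * ?N"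
    proof (rule onorm_le)
      fix v :: "complex ^ 'n"
      have "norm (?D x v) \<le> (\<Sum>k\<in>UNIV. (?N / (1 - (cmod (w $ k))\<^sup>2) powr p) * norm v)"
        by (intro order.trans[OF norm_sum] sum_mono)
           (auto simp: norm_mult simp del: times_divide_eq_left
              intro!: mult_mono grad Finite_Cartesian_Product.norm_nth_le bloch_norm_nonneg f divide_nonneg_nonneg)
      also have "\<dots> = ?K * ?N * norm v"
        by (simp add: sum_distrib_left sum_distrib_right mult_ac)
      finally show "norm (?D x v) \<le> ?K * ?N * norm v" .
    qed
  qed auto
  then show ?thesis by (simp add: mult_ac)
qed

section \<open>Functions of a single coordinate\<close>

lemma partial_deriv_nth:
  "partial_deriv k (\<lambda>z. g (z $ l)) z = (if k = l then deriv g (z $ l) else 0)"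
proof (cases "k = l")
  case True
  then show ?thesis by (simp add: partial_deriv_def)
next
  case False
  then show ?thesis by (auto simp: partial_deriv_def)
qed

text \<open>Only the \<open>l\<close>-th partial derivative survives, which reduces the estimates
  for the test functions to one complex variable.\<close>

lemma bloch_density_nth:
  fixes z :: "complex ^ 'n"
  shows "bloch_density p (\<lambda>z. g (z $ l)) z = cmod (deriv g (z $ l)) * (1 - (cmod (z $ l))\<^sup>2) powr p"
proof -
  have "bloch_density p (\<lambda>z. g (z $ l)) z
      = (\<Sum>k\<in>UNIV. if k = l then cmod (deriv g (z $ l)) * (1 - (cmod (z $ l))\<^sup>2) powr p else 0)"
    unfolding bloch_density_def partial_deriv_nth by (rule sum.cong) auto
  then show ?thesis by simp
qed

lemma holomorphic_cn_on_nth: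
  fixes l :: "'n::finite"
  assumes "g holomorphic_on ball 0 1"
  shows "holomorphic_cn_on (\<lambda>z :: complex ^ 'n. g (z $ l)) polydisc"
  unfolding holomorphic_cn_on_def
proof
  fix z :: "complex ^ 'n" assume "z \<in> polydisc"
  then have "z $ l \<in> ball 0 1" by (simp add: polydisc_def)
  then have "(g has_field_derivative deriv g (z $ l)) (at (z $ l))"
    using assms holomorphic_derivI by blast
  then have "(g has_derivative (*) (deriv g (z $ l))) (at (z $ l))"
    by (simp add: has_field_derivative_def)
  from has_derivative_compose[OF bounded_linear.has_derivative[OF bounded_linear_vec_nth has_derivative_ident] this]
  have "((\<lambda>z. g (z $ l)) has_derivative (\<lambda>v. deriv g (z $ l) * v $ l)) (at z within polydisc)" .
  then show "\<exists>D. ((\<lambda>z. g (z $ l)) has_derivative D) (at z within polydisc) \<and> (\<forall>c v. D (c *s v) = c * D v)"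
    by (intro exI conjI) auto
qed

text \<open>Powers of one coordinate are the monomials whose multi-index is supported at
  \<open>l\<close>; evaluating the multi-index at \<open>l\<close> recovers the exponent, so the sum
  can be reindexed.\<close>

lemma polynomial_fun_nth:
  "polynomial_fun (\<lambda>z :: complex ^ 'n. \<Sum>m<N. c m * (z $ l) ^ m)"
proof -
  let ?\<alpha> = "\<lambda>m i. if i = l then m else (0::nat)"
  have inj: "inj ?\<alpha>" by (rule injI) (metis (full_types))
  have prod: "(\<Prod>i\<in>UNIV. (z $ i) ^ ?\<alpha> m i) = (z $ l) ^ m" for z :: "complex ^ 'n" and m
    by (simp add: if_distrib[of "\<lambda>k. _ ^ k"] cong: if_cong)
  have "(\<Sum>m<N. c m * (z $ l) ^ m)
      = (\<Sum>\<alpha>\<in>?\<alpha> ` {..<N}. c (\<alpha> l) * (\<Prod>i\<in>UNIV. (z $ i) ^ \<alpha> i))" for z :: "complex ^ 'n"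
    using inj by (subst sum.reindex) (auto simp: prod inj_on_def)
  then show ?thesis unfolding polynomial_fun_def
    by (intro exI[of _ "?\<alpha> ` {..<N}"] exI[of _ "\<lambda>\<alpha>. c (\<alpha> l)"]) auto
qed

section \<open>Taylor approximation and membership in the little Bloch space\<close>

text \<open>Differentiation turns Taylor polynomials of \<open>g\<close> into partial sums of the
  power series of \<open>deriv g\<close>, whose radius of convergence exceeds \<open>1\<close>;
  these converge uniformly on the closed unit disc.\<close>

lemma deriv_taylor_poly_uniform_limit:
  assumes g: "g holomorphic_on ball 0 R" and "R > 1" and "e > 0"
  obtains N where "N > 0" "\<And>x. cmod x < 1 \<Longrightarrow>
    cmod (deriv (\<lambda>x. g x - (\<Sum>m<N. (deriv ^^ m) g 0 / fact m * x ^ m)) x) < e"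
proof -
  define c where "c = (\<lambda>m. (deriv ^^ m) g 0 / fact m)"
  have h: "deriv g holomorphic_on ball 0 R" using g by (intro holomorphic_deriv) auto
  define a where "a = (\<lambda>m. (deriv ^^ m) (deriv g) 0 / fact m)"
  have ca: "c (Suc m) * of_nat (Suc m) = a m" for m
    unfolding c_def a_def funpow_Suc_right o_apply fact_Suc by (simp add: field_simps del: of_nat_Suc)
  have "ereal 1 < conv_radius a"
  proof -
    \<comment> \<open>The midpoint of \<open>1\<close> and \<open>R\<close>: convergence at one
      point outside the closed unit disc makes the radius strictly larger than
      \<open>1\<close>.\<close>
    define r where "r = complex_of_real ((1 + R) / 2)"
    have r: "1 < cmod r" "cmod r < R"
      using \<open>R > 1\<close> unfolding r_def norm_of_real by auto
    then have "summable (\<lambda>m. a m * r ^ m)"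
      using holomorphic_power_series[OF h, of r] unfolding a_def by (simp add: sums_iff)
    then have "ereal (cmod r) \<le> conv_radius a"
      by (rule conv_radius_geI)
    with r show ?thesis by (meson ereal_less(2) less_ereal.simps(1) less_le_trans)
  qed
  then have "uniform_limit (cball 0 1) (\<lambda>N x. \<Sum>m<N. a m * (x - 0) ^ m) (\<lambda>x. \<Sum>m. a m * (x - 0) ^ m) sequentially"
    using powser_uniform_limit by blast
  then have "\<forall>\<^sub>F N in sequentially. \<forall>x\<in>cball 0 1. dist (\<Sum>m<N. a m * x ^ m) (\<Sum>m. a m * x ^ m) < e"
    using \<open>e > 0\<close> uniform_limitD by fastforce
  then obtain N where N: "\<And>x. x \<in> cball 0 1 \<Longrightarrow> dist (\<Sum>m<N. a m * x ^ m) (\<Sum>m. a m * x ^ m) < e"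
    unfolding eventually_sequentially by blast
  \<comment> \<open>Differentiation kills the constant term, so \<open>Suc N\<close> terms for
    \<open>g\<close> match \<open>N\<close> terms for \<open>deriv g\<close>. The shift also makes
    the cut-off positive.\<close>
  have "cmod (deriv (\<lambda>x. g x - (\<Sum>m<Suc N. c m * x ^ m)) x) < e" if x: "cmod x < 1" for x
  proof -
    have xR: "x \<in> ball 0 R" using x \<open>R > 1\<close> by simp
    have "((\<lambda>x. \<Sum>m<Suc N. c m * x ^ m) has_field_derivative
        (\<Sum>m<Suc N. c m * (of_nat m * x ^ (m - 1)))) (at x)"
      by (auto intro!: derivative_eq_intros simp: mult_ac)
    moreover have "(\<Sum>m<Suc N. c m * (of_nat m * x ^ (m - 1))) = (\<Sum>m<N. a m * x ^ m)"
      by (subst sum.lessThan_Suc_shift) (simp add: ca[symmetric] mult.assoc del: of_nat_Suc)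
    moreover have "(g has_field_derivative deriv g x) (at x)"
      using g xR holomorphic_derivI by blast
    ultimately have "((\<lambda>x. g x - (\<Sum>m<Suc N. c m * x ^ m)) has_field_derivative
        deriv g x - (\<Sum>m<N. a m * x ^ m)) (at x)"
      by (auto intro!: DERIV_diff)
    moreover have "deriv g x = (\<Sum>m. a m * x ^ m)"
      using holomorphic_power_series[OF h xR] unfolding a_def by (simp add: sums_iff)
    ultimately show ?thesis
      using N[of x] x by (simp add: DERIV_imp_deriv dist_norm norm_minus_commute)
  qed
  then show ?thesis using that[of "Suc N"] unfolding c_def by blast
qed

text \<open>The weight is at most \<open>1\<close>, so uniform closeness of derivatives on the unit
  disc gives closeness of Taylor polynomials in the Bloch density. The assumption
  \<open>bound\<close> puts the function itself into \<open>bloch p\<close>.\<close>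

lemma little_bloch_nth:
  fixes l :: "'n::finite"
  assumes g: "g holomorphic_on ball 0 R" and "R > 1" and "p > 0"
    and bound: "\<And>x. cmod x < 1 \<Longrightarrow> cmod (deriv g x) * (1 - (cmod x)\<^sup>2) powr p \<le> B"
  shows "(\<lambda>z :: complex ^ 'n. g (z $ l)) \<in> little_bloch p"
proof -
  let ?f = "\<lambda>z :: complex ^ 'n. g (z $ l)"
  have "g holomorphic_on ball 0 1"
    using g \<open>R > 1\<close> by (auto intro: holomorphic_on_subset)
  moreover have "bdd_above (bloch_density p ?f ` polydisc)"
    using bound by (auto simp: bdd_above_def bloch_density_nth polydisc_def)
  ultimately have "?f \<in> bloch p"
    by (simp add: bloch_def holomorphic_cn_on_nth)
  moreover have "\<exists>P. polynomial_fun P \<and> bloch_norm p (\<lambda>z. ?f z - P z) < e" if "e > 0" for e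
  proof -
    obtain N where "N > 0" and N: "\<And>x. cmod x < 1 \<Longrightarrow>
        cmod (deriv (\<lambda>x. g x - (\<Sum>m<N. (deriv ^^ m) g 0 / fact m * x ^ m)) x) < e / 2"
      using deriv_taylor_poly_uniform_limit[OF g \<open>R > 1\<close>, of "e / 2"] \<open>e > 0\<close> by auto
    let ?T = "\<lambda>x. \<Sum>m<N. (deriv ^^ m) g 0 / fact m * x ^ m"
    let ?r = "\<lambda>x. g x - ?T x"
    have "bloch_density p (\<lambda>z :: complex ^ 'n. ?r (z $ l)) z \<le> e / 2" if "z \<in> polydisc" for z
    proof -
      have z: "cmod (z $ l) < 1" using that by (simp add: polydisc_def)
      have "(1 - (cmod (z $ l))\<^sup>2) powr p \<le> 1"
        using one_minus_cmod_square_pos[OF z] \<open>p > 0\<close> by (intro powr_le1) auto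
      then show ?thesis
        unfolding bloch_density_nth[of p ?r l]
        using mult_mono[OF less_imp_le[OF N[OF z]]] \<open>e > 0\<close> by fastforce
    qed
    then have "bloch_norm p (\<lambda>z :: complex ^ 'n. ?r (z $ l)) \<le> cmod (?r ((0 :: complex ^ 'n) $ l)) + e / 2"
      by (rule bloch_norm_le)
    \<comment> \<open>A positive cut-off keeps the constant term, so the remainder vanishes at the
      origin and only the density bound \<open>e / 2\<close> is left.\<close>
    moreover have "?T 0 = g 0"
      using \<open>N > 0\<close> by (cases N) (simp_all add: sum.lessThan_Suc_shift del: sum.lessThan_Suc)
    ultimately have "bloch_norm p (\<lambda>z :: complex ^ 'n. ?r (z $ l)) < e" using \<open>e > 0\<close> by simp
    then show ?thesis using polynomial_fun_nth[of "\<lambda>m. (deriv ^^ m) g 0 / fact m" l N] by blast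
  qed
  ultimately show ?thesis by (simp add: little_bloch_def)
qed

section \<open>Extremal test functions on the disc\<close>

lemma bloch_test_function:
  assumes a: "cmod a < 1" and "p > 0"
  obtains g R where "R > 1" "g holomorphic_on ball 0 R" "g 0 = 0"
    "cmod (deriv g a) = 1 / (1 - (cmod a)\<^sup>2) powr p"
    "\<And>x. cmod x < 1 \<Longrightarrow> cmod (deriv g x) * (1 - (cmod x)\<^sup>2) powr p \<le> 2 powr p"
proof -
  \<comment> \<open>With \<open>R * cmod a < 1\<close>, the number \<open>1 - cnj a * x\<close> has
    positive real part throughout the ball, so the principal logarithm is holomorphic there.\<close>
  obtain R where R: "R > 1" "R * cmod a < 1"
  proof (cases "a = 0")
    case True
    then show ?thesis using that[of 2] by simp
  next
    case False
    then have "1 < 1 / cmod a" using a by simp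
    then obtain R where "1 < R" "R < 1 / cmod a" using dense by blast
    then show ?thesis using that[of R] False by (simp add: field_simps)
  qed
  define h where "h x = exp (- of_real p * Ln (1 - cnj a * x))" for x
  have Re_pos: "Re (1 - cnj a * x) > 0" if "x \<in> ball 0 R" for x
  proof -
    have "Re (cnj a * x) \<le> cmod a * cmod x"
      using complex_Re_le_cmod[of "cnj a * x"] by (simp add: norm_mult)
    also have "\<dots> \<le> cmod a * R" using that by (intro mult_left_mono) auto
    finally show ?thesis using R by (simp add: mult.commute)
  qed
  have nonneg: "1 - cnj a * x \<notin> \<real>\<^sub>\<le>\<^sub>0" if "x \<in> ball 0 R" for x
    using Re_pos[OF that] by (simp only: complex_nonpos_Reals_iff) linarith
  have h_norm: "cmod (h x) = 1 / cmod (1 - cnj a * x) powr p" if "x \<in> ball 0 R" for x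
  proof -
    have "1 - cnj a * x \<noteq> 0" using Re_pos[OF that] by (metis less_irrefl zero_complex.sel(1))
    then show ?thesis
      by (simp add: h_def powr_def exp_minus inverse_eq_divide norm_divide)
  qed
  have "h holomorphic_on ball 0 R"
    unfolding h_def using nonneg by (intro holomorphic_intros) auto
  then obtain g0 where g0: "\<And>x. x \<in> ball 0 R \<Longrightarrow> (g0 has_field_derivative h x) (at x)"
    using holomorphic_convex_primitive'[of "ball 0 R" h] at_within_open[of _ "ball 0 R"]
    by (metis convex_ball open_ball)
  \<comment> \<open>The primitive is normalised to vanish at \<open>0\<close>, so that the point
    value contributes nothing to the Bloch norm.\<close>
  define g where "g x = g0 x - g0 0" for x
  have g: "(g has_field_derivative h x) (at x)" if "x \<in> ball 0 R" for x
    unfolding g_def using g0[OF that] by (auto intro!: derivative_eq_intros)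
  have dg: "deriv g x = h x" if "cmod x < 1" for x
    using g[of x] that R by (simp add: DERIV_imp_deriv)
  show ?thesis
  proof
    show "g holomorphic_on ball 0 R"
      unfolding holomorphic_on_open[OF open_ball] using g by blast
    \<comment> \<open>At \<open>x = a\<close> the base of the power is real and positive, so the
      derivative of \<open>g\<close> has exactly the reciprocal weight as its modulus.\<close>
    have "cmod (1 - cnj a * a) = 1 - (cmod a)\<^sup>2"
    proof -
      have "1 - cnj a * a = of_real (1 - (cmod a)\<^sup>2)"
        by (simp only: of_real_diff of_real_1 complex_norm_square) simp
      then show ?thesis using one_minus_cmod_square_pos[OF a] by (metis abs_of_pos norm_of_real)
    qed
    then show "cmod (deriv g a) = 1 / (1 - (cmod a)\<^sup>2) powr p"
      using a R by (simp add: dg h_norm)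
    fix x assume x: "cmod x < 1"
    \<comment> \<open>This is \<open>(1 - cmod x)^2 \<ge> 0\<close> rearranged; it is the source of
      the constant \<open>2 powr p\<close>.\<close>
    have "1 - (cmod x)\<^sup>2 \<le> 2 * (1 - cmod x)"
      using sum_power2_ge_zero[of "1 - cmod x" 0] by (simp add: power2_eq_square algebra_simps)
    also have "\<dots> \<le> 2 * cmod (1 - cnj a * x)"
    proof -
      have "cmod a * cmod x \<le> cmod x" using a by (simp add: mult_left_le_one_le)
      then show ?thesis
        using norm_triangle_ineq2[of 1 "cnj a * x"] by (simp add: norm_mult)
    qed
    finally have "(1 - (cmod x)\<^sup>2) powr p \<le> (2 * cmod (1 - cnj a * x)) powr p"
      using one_minus_cmod_square_pos[OF x] \<open>p > 0\<close> by (intro powr_mono2) auto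
    also have "\<dots> = 2 powr p * cmod (1 - cnj a * x) powr p"
      by (simp add: powr_mult)
    finally have *: "(1 - (cmod x)\<^sup>2) powr p \<le> 2 powr p * cmod (1 - cnj a * x) powr p" .
    have xR: "x \<in> ball 0 R" using x R by simp
    have "1 - cnj a * x \<noteq> 0" using Re_pos[OF xR] by (metis less_irrefl zero_complex.sel(1))
    then show "cmod (deriv g x) * (1 - (cmod x)\<^sup>2) powr p \<le> 2 powr p"
      using * by (simp add: dg[OF x] h_norm[OF xR] divide_le_eq)
  qed (use R in \<open>auto simp: g_def\<close>)
qed

section \<open>Equivalence of the two boundedness statements and the derivative condition\<close>

theorem theorem3p1:
  fixes \<phi> :: "complex ^ 'n \<Rightarrow> complex ^ 'n" and p q :: real
  assumes "holomorphic_map_on \<phi> polydisc"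
    and "\<phi> ` polydisc \<subseteq> polydisc"
    and "p > 0" and "q > 0"
  shows "(bounded_operator (comp_op \<phi>) (bloch p) (bloch_norm p) (bloch q) (bloch_norm q)
            \<longleftrightarrow> bounded_operator (comp_op \<phi>) (little_bloch p) (bloch_norm p) (bloch q) (bloch_norm q))
       \<and> (bounded_operator (comp_op \<phi>) (little_bloch p) (bloch_norm p) (bloch q) (bloch_norm q)
            \<longleftrightarrow> (\<exists>M\<ge>0. \<forall>z\<in>polydisc.
                  (\<Sum>k\<in>UNIV. \<Sum>l\<in>UNIV. cmod (partial_deriv k (\<lambda>w. \<phi> w $ l) z)
                     * ((1 - (cmod (z $ k))\<^sup>2) powr q / (1 - (cmod (\<phi> z $ l))\<^sup>2) powr p)) \<le> M))"
    (is "(?a \<longleftrightarrow> ?b) \<and> (?b \<longleftrightarrow> ?c)")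
proof -
  have "?b" if "?a"
    using that unfolding bounded_operator_def little_bloch_def by blast
  moreover have "?c" if b: "?b"
  proof -
    obtain C where maps: "comp_op \<phi> ` little_bloch p \<subseteq> bloch q"
      and C: "\<And>f. f \<in> little_bloch p \<Longrightarrow> bloch_norm q (comp_op \<phi> f) \<le> C * bloch_norm p f"
      using b unfolding bounded_operator_def by blast
    \<comment> \<open>The bound is uniform in both \<open>z\<close> and \<open>l\<close>, because
      the test functions have norm at most \<open>2 powr p\<close> wherever \<open>\<phi> z\<close>
      lies. The absolute value covers a negative \<open>C\<close>.\<close>
    have col: "(\<Sum>k\<in>UNIV. cmod (partial_deriv k (\<lambda>w. \<phi> w $ l) z)
        * ((1 - (cmod (z $ k))\<^sup>2) powr q / (1 - (cmod (\<phi> z $ l))\<^sup>2) powr p)) \<le> \<bar>C\<bar> * 2 powr p"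
      if z: "z \<in> polydisc" for z l
    proof -
      have \<phi>z: "\<phi> z \<in> polydisc" using assms z by blast
      then have "cmod (\<phi> z $ l) < 1" by (simp add: polydisc_def)
      then obtain g R where R: "R > 1" and g: "g holomorphic_on ball 0 R" and g0: "g 0 = 0"
        and ga: "cmod (deriv g (\<phi> z $ l)) = 1 / (1 - (cmod (\<phi> z $ l))\<^sup>2) powr p"
        and gb: "\<And>x. cmod x < 1 \<Longrightarrow> cmod (deriv g x) * (1 - (cmod x)\<^sup>2) powr p \<le> 2 powr p"
        using bloch_test_function \<open>p > 0\<close> by metis
      define f where "f = (\<lambda>z :: complex ^ 'n. g (z $ l))"
      have f: "f \<in> little_bloch p"
        unfolding f_def using g R \<open>p > 0\<close> gb by (rule little_bloch_nth)
      then have fb: "f \<in> bloch p" by (simp add: little_bloch_def)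
      then have hol: "holomorphic_cn_on f polydisc" by (simp add: bloch_def)
      have f_norm: "bloch_norm p f \<le> 2 powr p"
      proof -
        have "bloch_norm p f \<le> cmod (f 0) + 2 powr p"
          by (rule bloch_norm_le) (simp add: f_def bloch_density_nth gb polydisc_def)
        then show ?thesis by (simp add: f_def g0)
      qed
      have pd: "partial_deriv k (f \<circ> \<phi>) z = deriv g (\<phi> z $ l) * partial_deriv k (\<lambda>w. \<phi> w $ l) z" for k
      proof -
        have "partial_deriv k (f \<circ> \<phi>) z
            = (\<Sum>j\<in>UNIV. if j = l then deriv g (\<phi> z $ l) * partial_deriv k (\<lambda>w. \<phi> w $ l) z else 0)"
          unfolding partial_deriv_comp[OF assms(1,2) hol z]
          by (rule sum.cong) (auto simp: f_def partial_deriv_nth)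
        then show ?thesis by simp
      qed
      \<comment> \<open>By \<open>ga\<close> the reciprocal weight equals the modulus of
        \<open>deriv g\<close> at \<open>\<phi> z $ l\<close>, which is the factor that
        \<open>pd\<close> produces.\<close>
      have "(\<Sum>k\<in>UNIV. cmod (partial_deriv k (\<lambda>w. \<phi> w $ l) z)
          * ((1 - (cmod (z $ k))\<^sup>2) powr q / (1 - (cmod (\<phi> z $ l))\<^sup>2) powr p)) = bloch_density q (f \<circ> \<phi>) z"
        unfolding bloch_density_def pd norm_mult ga by (simp add: mult_ac)
      also have "\<dots> \<le> bloch_norm q (f \<circ> \<phi>)"
        using maps f z by (intro bloch_density_le_norm) (auto simp: comp_op_def)
      also have "\<dots> \<le> C * bloch_norm p f" using C[OF f] by (simp add: comp_op_def)
      also have "\<dots> \<le> \<bar>C\<bar> * 2 powr p"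
        using f_norm bloch_norm_nonneg[OF fb] by (intro mult_mono) auto
      finally show ?thesis .
    qed
    \<comment> \<open>Swapping the sums puts \<open>l\<close> outside; the witness is the bound for
      one \<open>l\<close>, added over all coordinates.\<close>
    show ?c
    proof (intro exI conjI ballI)
      fix z :: "complex ^ 'n" assume "z \<in> polydisc"
      then show "(\<Sum>k\<in>UNIV. \<Sum>l\<in>UNIV. cmod (partial_deriv k (\<lambda>w. \<phi> w $ l) z)
          * ((1 - (cmod (z $ k))\<^sup>2) powr q / (1 - (cmod (\<phi> z $ l))\<^sup>2) powr p))
          \<le> (\<Sum>l\<in>(UNIV :: 'n set). \<bar>C\<bar> * 2 powr p)"
        by (subst sum.swap) (intro sum_mono col)
    qed (simp add: sum_nonneg)
  qed
  moreover have "?a" if c: "?c"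
  proof -
    obtain M where "M \<ge> 0" and M: "\<And>z. z \<in> polydisc \<Longrightarrow>
        (\<Sum>k\<in>UNIV. \<Sum>l\<in>UNIV. cmod (partial_deriv k (\<lambda>w. \<phi> w $ l) z)
          * ((1 - (cmod (z $ k))\<^sup>2) powr q / (1 - (cmod (\<phi> z $ l))\<^sup>2) powr p)) \<le> M"
      using c by blast
    note dens = bloch_density_comp_le[OF assms(1,2) _ _ M]
    \<comment> \<open>The growth constant at the point \<open>\<phi> 0\<close>, which controls the
      value of \<open>f \<circ> \<phi>\<close> at the origin.\<close>
    define K where "K = (\<Sum>l\<in>UNIV. 1 / (1 - (cmod (\<phi> 0 $ l))\<^sup>2) powr p) * norm (\<phi> 0)"
    have \<phi>0: "\<phi> 0 \<in> polydisc" using assms zero_in_polydisc by blast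
    have "f \<circ> \<phi> \<in> bloch q" if f: "f \<in> bloch p" for f
    proof -
      have "holomorphic_cn_on (f \<circ> \<phi>) polydisc"
        using comp_holomorphic[OF assms(1,2)] f by (simp add: bloch_def)
      moreover have "bdd_above (bloch_density q (f \<circ> \<phi>) ` polydisc)"
        using dens[OF f] by (intro bdd_aboveI2) auto
      ultimately show ?thesis by (simp add: bloch_def)
    qed
    \<comment> \<open>The three parts of the constant account for \<open>f 0\<close>, the change of
      \<open>f\<close> from \<open>0\<close> to \<open>\<phi> 0\<close>, and the density of the
      composition.\<close>
    moreover have "bloch_norm q (f \<circ> \<phi>) \<le> (1 + K + M) * bloch_norm p f" if f: "f \<in> bloch p" for f
    proof -
      have "bloch_norm q (f \<circ> \<phi>) \<le> cmod (f (\<phi> 0)) + M * bloch_norm p f"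
        using bloch_norm_le[OF dens[OF f]] by simp
      moreover have "cmod (f (\<phi> 0)) \<le> cmod (f 0) + cmod (f (\<phi> 0) - f 0)"
        by (rule norm_triangle_sub)
      moreover have "cmod (f (\<phi> 0) - f 0) \<le> K * bloch_norm p f"
        unfolding K_def by (rule bloch_growth[OF f \<phi>0 \<open>p > 0\<close>])
      ultimately show ?thesis
        using cmod_0_le_bloch_norm[OF f] by (simp add: distrib_right)
    qed
    ultimately show ?a unfolding bounded_operator_def comp_op_def by blast
  qed
  ultimately show ?thesis by blast
qed

end
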